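(* Let $T>0$, $q\ge 1$, let $U$ be a bounded subset of $V$, and let $\mathcal U_{ad}=\{f\in L^q(0,T;V): f(s)\in U \text{ for a.e. } s\in[0,T]\}$ (with the analogous definition for other final times). Assume: (a) for each $N\ge1$ the linear flow $e^{L_N t}:\mathcal H_N\to\mathcal H_N$ extends to a $C_0$-semigroup $T_N(t)$ on $\mathcal H$ with $\|T_N(t)\|\le M e^{\omega t}$ for all $N\ge 1$, $t\ge0$; $\lim_{N\to\infty}\|L_N\phi-L\phi\|_{\mathcal H}=0$ for all $\phi\in D(L)$; and $F:\mathcal H\to\mathcal H$ is locally Lipschitz; (b) $L$ is self-adjoint and $\mathcal H_N=\mathrm{span}\{e_k:k=1,\dots,N\}$, $N\ge1$, where the $e_k$ are the eigenfunctions of $L$; (c) for each $T>0$ and $(x,u)\in\mathcal H\times\mathcal U_{ad}$, the state equation admits a unique mild solution $y(\cdot;x,u)\in C([0,T],\mathcal H)$ and, for each $N\ge1$, its Galerkin approximation admits a unique solution $y_N(\cdot;\Pi_N x,u)\in C([0,T],\mathcal H)$; moreover there is a constant $\mathcal C=\mathcal C(T,x)$ such that $\|y(t;x,u)\|_{\mathcal H}\le\mathcal C$ and $\|y_N(t;\Pi_Nx,u)\|_{\mathcal H}\le\mathcal C$ for all $t\in[0,T]$, $N\ge1$, $u\in\mathcal U_{ad}$; (d) $\mathcal G:\mathcal H\to[0,\infty)$ is locally Lipschitz and $\mathcal E:V\to[0,\infty)$ is continuous; (e) for each $(t,x)\in[0,T)\times\mathcal H$ there exists a minimizer $u^*_{t,x}$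 of $J_{t,x}$ over $\mathcal U_{ad}[t,T]$ and, for each $N\ge1$, a minimizer $u^{N,*}_{t,x_N}$ of $J^N_{t,x_N}$ over $\mathcal U_{ad}[t,T]$, where $x_N=\Pi_Nx$. Fix $x\in\mathcal H$ and put $u^*:=u^*_{0,x}$, $u^*_N:=u^{N,*}_{0,x_N}$ and $J(x,u):=J_{0,x}(u)$. Assume furthermore that there exist $\sigma>0$ and a neighborhood $\mathcal W\subset\mathcal U_{ad}$ of $u^*$ such that $$\sigma\|u^*-v\|^q_{L^q(0,T;V)}\le J(x,v)-J(x,u^* )\qquad\text{for all }v\in\mathcal W.$$ Then there exists a constant $\gamma>0$, independent of $N$ and of the control, such that for all $N\ge1$ and all $u\in\mathcal U_{ad}$ $$|J_{0,x}(u)-J^N_{0,x_N}(u)|\le\mathrm{Lip}(\mathcal G|_{\mathfrak B})\big[\sqrt{T}+\gamma T\big]\,\|\Pi_N^\perp y(\cdot;x,u)\|_{L^2(0,T;\mathcal H)},$$ and, with this same constant $\gamma$, for every $N\ge1$ such that $u^*_N\in\mathcal W$, $$\|u^*-u^*_N\|^q_{L^q(0,T;V)}\le\frac1\sigma\,\mathrm{Lip}(\mathcal G|_{\mathfrak B})\big[\sqrt T+\gamma T\big]\Big(\|\Pi_N^\perp y(\cdot;x,u^* )\|_{L^2(0,T;\mathcal H)}+2\|\Pi_N^\perp y(\cdot;x,u^*_N)\|_{L^2(0,T;\mathcal H)}\Big).$$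
   Context: $\mathcal H$ and $V$ are separable Hilbert spaces; $F:\mathcal H\to\mathcal H$ and $\mathfrak C:V\to\mathcal H$ are (possibly nonlinear) maps, with $\mathfrak C(0)=0$. The operator $L:D(L)\subset\mathcal H\to\mathcal H$ is the infinitesimal generator of a $C_0$-semigroup $(T(t))_{t\ge0}$ of bounded linear operators on $\mathcal H$, and $M\ge1$, $\omega\ge0$ are constants with $\|T(t)\|\le Me^{\omega t}$ for $t\ge0$ ($\|\cdot\|$ is the operator norm). (The letter $T$ alone denotes the final time.) State equation: $\frac{dy}{dt}=Ly+F(y)+\mathfrak C(u(t))$ on $(0,T]$, $y(0)=x\in\mathcal H$. A mild solution over $[0,T]$ is $y\in C([0,T],\mathcal H)$ with $y(t)=T(t)x+\int_0^tT(t-s)F(y(s))\,ds+\int_0^tT(t-s)\mathfrak C(u(s))\,ds$ for $t\in[0,T]$; it is denoted $y(\cdot;x,u)$. Galerkin approximation: $(\mathcal H_N)_{N\ge1}$ is a sequence of finite-dimensional subspaces of $\mathcal H$ with $\mathcal H_N\subset D(L)$, $\Pi_N:\mathcal H\to\mathcal H_N$ is the orthogonal projector, and $\|(\Pi_N-\mathrm{Id})x\|_{\mathcal H}\to0$ as $N\to\infty$ for all $x\in\mathcal H$. Put $L_N:=\Pi_NL\Pi_N:\mathcal H\to\mathcal H_N$ and $\Pi_N^\perp:=\mathrm{Id}_{\mathcal H}-\Pi_N$. The Galerkin approximation is $\frac{dy_N}{dt}=L_Ny_N+\Pi_NF(y_N)+\Pi_N\mathfrak C(u(t))$ on $[0,T]$,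 $y_N(0)=\Pi_Nx$, understood through the variation-of-constants formula $y_N(t)=e^{L_Nt}\Pi_Nx+\int_0^te^{L_N(t-s)}\Pi_NF(y_N(s))\,ds+\int_0^te^{L_N(t-s)}\Pi_N\mathfrak C(u(s))\,ds$; its solution is denoted $y_N(\cdot;\Pi_Nx,u)$. Problems started at time $t$: for $t\in[0,T)$ put $\mathcal U_{ad}[t,T]:=\{u|_{[t,T]}:u\in\mathcal U_{ad}\}$ (so $\mathcal U_{ad}[0,T]=\mathcal U_{ad}$). For $u\in\mathcal U_{ad}[t,T]$, $y_{t,x}(\cdot;u)$ denotes the mild solution over $[t,T]$ of $\frac{dy}{ds}=Ly+F(y)+\mathfrak C(u(s))$, $s\in(t,T]$, $y(t)=x$, and $y^N_{t,x_N}(\cdot;u)$ denotes the solution of $\frac{dy_N}{ds}=L_Ny_N+\Pi_NF(y_N)+\Pi_N\mathfrak C(u(s))$, $s\in(t,T]$, $y_N(t)=x_N:=\Pi_Nx$. In particular $y_{0,x}(\cdot;u)=y(\cdot;x,u)$. Cost functionals: for $t\in[0,T)$ and $u\in\mathcal U_{ad}[t,T]$, $$J_{t,x}(u):=\int_t^T[\mathcal G(y_{t,x}(s;u))+\mathcal E(u(s))]\,ds,\qquad J^N_{t,x_N}(u):=\int_t^T[\mathcal G(y^N_{t,x_N}(s;u))+\mathcal E(u(s))]\,ds.$$ $\mathcal U_{ad}$ carries the topology induced by $L^q(0,T;V)$. A map $f:\mathcal W_1\to\mathcal W_2$ between Banach spaces is locally Lipschitz if for every ball $\mathfrak B_r\subset\mathcal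 W_1$ of radius $r$ centered at the origin there is a constant $\mathrm{Lip}(f|_{\mathfrak B_r})>0$ with $\|f(y_1)-f(y_2)\|\le\mathrm{Lip}(f|_{\mathfrak B_r})\|y_1-y_2\|$ on $\mathfrak B_r$. $\mathfrak B$ denotes the (closed) ball of $\mathcal H$ centered at the origin with radius $\mathcal C=\mathcal C(T,x)$, the constant in hypothesis (c). *)

theory Defs
  imports "HOL-Analysis.Analysis"
begin

text \<open>Separable (real) Hilbert spaces are rendered by the sort
  \<open>{real_inner, banach, second_countable_topology}\<close>.\<close>

section \<open>Semigroups and unbounded operators\<close>

definition c0_semigroup :: "(real \<Rightarrow> 'h::real_normed_vector \<Rightarrow>\<^sub>L 'h) \<Rightarrow> bool" where
  "c0_semigroup S \<longleftrightarrow>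
     S 0 = id_blinfun \<and>
     (\<forall>s\<ge>0. \<forall>t\<ge>0. S (s + t) = S s o\<^sub>L S t) \<and>
     (\<forall>x. ((\<lambda>t. S t x) \<longlongrightarrow> x) (at_right 0))"

text \<open>An operator \<open>L : D \<subseteq> H \<rightarrow> H\<close> is a total function together with its domain \<open>D\<close>;
  the values of \<open>L\<close> outside \<open>D\<close> are irrelevant.\<close>

definition is_generator ::
    "(real \<Rightarrow> 'h::real_normed_vector \<Rightarrow>\<^sub>L 'h) \<Rightarrow> 'h set \<Rightarrow> ('h \<Rightarrow> 'h) \<Rightarrow> bool" where
  "is_generator S D L \<longleftrightarrow>
     D = {x. \<exists>l. ((\<lambda>h. (S h x - x) /\<^sub>R h) \<longlongrightarrow> l) (at_right 0)} \<and>
     (\<forall>x\<in>D. ((\<lambda>h. (S h x - x) /\<^sub>R h) \<longlongrightarrow> L x) (at_right 0))"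

definition is_adjoint ::
    "'h::real_inner set \<Rightarrow> ('h \<Rightarrow> 'h) \<Rightarrow> 'h set \<Rightarrow> ('h \<Rightarrow> 'h) \<Rightarrow> bool" where
  "is_adjoint D L D' L' \<longleftrightarrow>
     D' = {y. \<exists>z. \<forall>x\<in>D. inner (L x) y = inner x z} \<and>
     (\<forall>y\<in>D'. \<forall>x\<in>D. inner (L x) y = inner x (L' y))"

text \<open>The domain has to agree with that of the adjoint: this is more than symmetry.\<close>

definition self_adjoint :: "'h::real_inner set \<Rightarrow> ('h \<Rightarrow> 'h) \<Rightarrow> bool" where
  "self_adjoint D L \<longleftrightarrow> closure D = UNIV \<and> is_adjoint D L D L"

section \<open>Galerkin operators\<close>

text \<open>Only applied to finite-dimensional subspaces \<open>K\<close>, for which the orthogonal projection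
  of every \<open>x\<close> exists.\<close>

definition orth_proj :: "'h::real_inner set \<Rightarrow> 'h \<Rightarrow> 'h" where
  "orth_proj K x = (THE p. p \<in> K \<and> (\<forall>k\<in>K. inner (x - p) k = 0))"

definition galerkin_op :: "('h::real_inner \<Rightarrow> 'h) \<Rightarrow> 'h set \<Rightarrow> 'h \<Rightarrow> 'h" where
  "galerkin_op L K x = orth_proj K (L (orth_proj K x))"

text \<open>\<open>e\<^bsup>tA\<^esup> x\<close> for a bounded linear \<open>A\<close>. The library's \<open>exp\<close> needs a normed algebra,
  whereas bounded operators carry no multiplication there.\<close>

definition exp_op :: "('h::real_normed_vector \<Rightarrow> 'h) \<Rightarrow> real \<Rightarrow> 'h \<Rightarrow> 'h" where
  "exp_op A t x = (\<Sum>n. (t ^ n / fact n) *\<^sub>R (A ^^ n) x)"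

section \<open>Mild solutions\<close>

text \<open>Mild solution of \<open>y' = A y + f y + g\<close>, \<open>y a = x\<close> over \<open>[a, b]\<close>, where \<open>S\<close> is the flow
  of \<open>A\<close>. Since the Bochner integral of a non-integrable function is \<open>0\<close> by convention,
  existence of the two integrals is required explicitly.\<close>

definition mild_solution ::
    "(real \<Rightarrow> 'h::{banach, second_countable_topology} \<Rightarrow> 'h) \<Rightarrow> ('h \<Rightarrow> 'h) \<Rightarrow> (real \<Rightarrow> 'h) \<Rightarrow>
     real \<Rightarrow> real \<Rightarrow> 'h \<Rightarrow> (real \<Rightarrow> 'h) \<Rightarrow> bool" where
  "mild_solution S f g a b x y \<longleftrightarrow>
     continuous_on {a..b} y \<and>
     (\<forall>t\<in>{a..b}.
        integrable (lebesgue_on {a..t}) (\<lambda>s. S (t - s) (f (y s))) \<and>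
        integrable (lebesgue_on {a..t}) (\<lambda>s. S (t - s) (g s)) \<and>
        y t = S (t - a) x
          + (\<integral>s. S (t - s) (f (y s)) \<partial>lebesgue_on {a..t})
          + (\<integral>s. S (t - s) (g s) \<partial>lebesgue_on {a..t}))"

definition is_state_solution ::
    "(real \<Rightarrow> 'h::{real_inner, banach, second_countable_topology} \<Rightarrow>\<^sub>L 'h) \<Rightarrow> ('h \<Rightarrow> 'h) \<Rightarrow>
     ('v \<Rightarrow> 'h) \<Rightarrow> real \<Rightarrow> real \<Rightarrow> 'h \<Rightarrow> (real \<Rightarrow> 'v) \<Rightarrow> (real \<Rightarrow> 'h) \<Rightarrow> bool" where
  "is_state_solution S F C a b x u y \<longleftrightarrow>
     mild_solution (\<lambda>t. blinfun_apply (S t)) F (\<lambda>s. C (u s)) a b x y"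

definition is_galerkin_solution ::
    "('h::{real_inner, banach, second_countable_topology} \<Rightarrow> 'h) \<Rightarrow> 'h set \<Rightarrow> ('h \<Rightarrow> 'h) \<Rightarrow>
     ('v \<Rightarrow> 'h) \<Rightarrow> real \<Rightarrow> real \<Rightarrow> 'h \<Rightarrow> (real \<Rightarrow> 'v) \<Rightarrow> (real \<Rightarrow> 'h) \<Rightarrow> bool" where
  "is_galerkin_solution L K F C a b xK u y \<longleftrightarrow>
     mild_solution (exp_op (galerkin_op L K)) (\<lambda>z. orth_proj K (F z))
       (\<lambda>s. orth_proj K (C (u s))) a b xK y"

text \<open>Elements of \<open>C([a, b], H)\<close> are functions on \<open>real\<close> whose values outside \<open>[a, b]\<close> are
  irrelevant, so uniqueness means equality on \<open>[a, b]\<close>.\<close>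

definition uniquely_solvable :: "real \<Rightarrow> real \<Rightarrow> ((real \<Rightarrow> 'h) \<Rightarrow> bool) \<Rightarrow> bool" where
  "uniquely_solvable a b P \<longleftrightarrow>
     (\<exists>y. P y) \<and> (\<forall>y z. P y \<and> P z \<longrightarrow> (\<forall>t\<in>{a..b}. y t = z t))"

text \<open>\<open>y\<^bsub>a,x\<^esub>(\<cdot>; u)\<close> and \<open>y\<^sup>N\<^bsub>a,x\<^esub>(\<cdot>; u)\<close> over \<open>[a, b]\<close>.\<close>

definition state_sol ::
    "(real \<Rightarrow> 'h::{real_inner, banach, second_countable_topology} \<Rightarrow>\<^sub>L 'h) \<Rightarrow> ('h \<Rightarrow> 'h) \<Rightarrow>
     ('v \<Rightarrow> 'h) \<Rightarrow> real \<Rightarrow> real \<Rightarrow> 'h \<Rightarrow> (real \<Rightarrow> 'v) \<Rightarrow> real \<Rightarrow> 'h" where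
  "state_sol S F C a b x u = (SOME y. is_state_solution S F C a b x u y)"

definition galerkin_sol ::
    "('h::{real_inner, banach, second_countable_topology} \<Rightarrow> 'h) \<Rightarrow> 'h set \<Rightarrow> ('h \<Rightarrow> 'h) \<Rightarrow>
     ('v \<Rightarrow> 'h) \<Rightarrow> real \<Rightarrow> real \<Rightarrow> 'h \<Rightarrow> (real \<Rightarrow> 'v) \<Rightarrow> real \<Rightarrow> 'h" where
  "galerkin_sol L K F C a b xK u = (SOME y. is_galerkin_solution L K F C a b xK u y)"

section \<open>Controls\<close>

definition Lp_norm :: "real \<Rightarrow> real \<Rightarrow> real \<Rightarrow> (real \<Rightarrow> 'b::real_normed_vector) \<Rightarrow> real" where
  "Lp_norm p a b f = (\<integral>s. norm (f s) powr p \<partial>lebesgue_on {a..b}) powr (1 / p)"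

text \<open>Elements of \<open>L\<^sup>q(0,T;V)\<close> are represented by functions rather than by classes modulo
  equality almost everywhere; mild solutions and costs do not see the difference.\<close>

definition admissible :: "real \<Rightarrow> 'v::real_normed_vector set \<Rightarrow> real \<Rightarrow> (real \<Rightarrow> 'v) set" where
  "admissible q U T =
     {u \<in> borel_measurable (lebesgue_on {0..T}).
        integrable (lebesgue_on {0..T}) (\<lambda>s. norm (u s) powr q) \<and>
        (AE s in lebesgue_on {0..T}. u s \<in> U)}"

text \<open>\<open>\<U>\<^bsub>ad\<^esub>[t,T]\<close>, the restrictions to \<open>[t, T]\<close>: only the values on \<open>[t, T]\<close> are prescribed.
  For \<open>t = 0\<close> this is \<^term>\<open>admissible q U T\<close> itself.\<close>

definition admissible_from ::
    "real \<Rightarrow> 'v::real_normed_vector set \<Rightarrow> real \<Rightarrow> real \<Rightarrow> (real \<Rightarrow> 'v) set" where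
  "admissible_from q U t T = {u. \<exists>v\<in>admissible q U T. \<forall>s\<in>{t..T}. u s = v s}"

section \<open>Cost functionals\<close>

text \<open>A continuous \<open>E \<ge> 0\<close> need not be bounded on a bounded subset of an infinite-dimensional
  space, so a control may have infinite cost; hence the values in \<open>[0, \<infinity>]\<close>. Constant controls
  have finite cost, hence so do minimizers, and differences \<open>J v - J u\<close> with a minimizer \<open>u\<close> make
  sense.\<close>

definition cost_J ::
    "(real \<Rightarrow> 'h::{real_inner, banach, second_countable_topology} \<Rightarrow>\<^sub>L 'h) \<Rightarrow> ('h \<Rightarrow> 'h) \<Rightarrow>
     ('v \<Rightarrow> 'h) \<Rightarrow> ('h \<Rightarrow> real) \<Rightarrow> ('v \<Rightarrow> real) \<Rightarrow>
     real \<Rightarrow> real \<Rightarrow> 'h \<Rightarrow> (real \<Rightarrow> 'v) \<Rightarrow> ennreal" where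
  "cost_J S F C G E T t x u =
     (\<integral>\<^sup>+ s. ennreal (G (state_sol S F C t T x u s) + E (u s)) \<partial>lebesgue_on {t..T})"

definition cost_JN ::
    "('h::{real_inner, banach, second_countable_topology} \<Rightarrow> 'h) \<Rightarrow> 'h set \<Rightarrow> ('h \<Rightarrow> 'h) \<Rightarrow>
     ('v \<Rightarrow> 'h) \<Rightarrow> ('h \<Rightarrow> real) \<Rightarrow> ('v \<Rightarrow> real) \<Rightarrow>
     real \<Rightarrow> real \<Rightarrow> 'h \<Rightarrow> (real \<Rightarrow> 'v) \<Rightarrow> ennreal" where
  "cost_JN L K F C G E T t xK u =
     (\<integral>\<^sup>+ s. ennreal (G (galerkin_sol L K F C t T xK u s) + E (u s)) \<partial>lebesgue_on {t..T})"

definition locally_lipschitz :: "('a::real_normed_vector \<Rightarrow> 'b::real_normed_vector) \<Rightarrow> bool" where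
  "locally_lipschitz f \<longleftrightarrow> (\<forall>r>0. \<exists>K>0. K-lipschitz_on (cball 0 r) f)"

end

theory Submission
  imports Defs
begin

text \<open>The spaces \<open>H\<^sub>N\<close> are spanned by eigenvectors of the self-adjoint generator, so \<open>\<Pi>\<^sub>N\<close> commutes
  with the semigroup \<open>S\<close>, and \<open>e\<^bsup>tL\<^sub>N\<^esup>\<close> is the restriction of \<open>S t\<close> to \<open>H\<^sub>N\<close>. Hence \<open>\<Pi>\<^sub>N y\<close> and
  \<open>y\<^sub>N\<close> satisfy the same variation-of-constants formula up to replacing \<open>F y\<close> by \<open>F y\<^sub>N\<close>, and
  Gronwall's inequality bounds \<open>\<Pi>\<^sub>N y - y\<^sub>N\<close> uniformly on \<open>[0, T]\<close> by a multiple of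
  \<open>\<parallel>y - \<Pi>\<^sub>N y\<parallel>\<^bsub>L\<^sup>1\<^esub>\<close>, hence of the \<open>L\<^sup>2\<close> norm. Integrating the Lipschitz bound for \<open>G\<close> gives the cost
  estimate. For the controls, \<open>J(u\<^sub>N\<^sup>*) - J(u\<^sup>*) \<le> (J - J\<^sub>N)(u\<^sub>N\<^sup>*) + (J\<^sub>N - J)(u\<^sup>*)\<close> since \<open>u\<^sub>N\<^sup>*\<close>
  minimizes \<open>J\<^sub>N\<close>; this even gives the factor \<open>1\<close> in place of \<open>2\<close>.\<close>

section \<open>Orthogonal projections\<close>

text \<open>One Gram-Schmidt step per generator: \<open>d\<close> is the part of the new vector
  \<open>b\<close> orthogonal to \<open>span B\<close>, and the projection of \<open>x\<close> onto
  \<open>span B\<close> is corrected along \<open>d\<close>. No independence of \<open>B\<close> is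
  assumed, so \<open>d\<close> may be zero.\<close>

lemma orth_proj_exists:
  fixes x :: "'a::real_inner"
  assumes "finite B"
  shows "\<exists>p\<in>span B. \<forall>k\<in>span B. inner (x - p) k = 0"
  using assms
proof (induction B arbitrary: x rule: finite_induct)
  case empty
  then show ?case by auto
next
  case (insert b B)
  obtain q where q: "q \<in> span B" "\<And>k. k \<in> span B \<Longrightarrow> inner (b - q) k = 0"
    using insert.IH by blast
  obtain p where p: "p \<in> span B" "\<And>k. k \<in> span B \<Longrightarrow> inner (x - p) k = 0"
    using insert.IH by blast
  define d where "d = b - q"
  \<comment> \<open>If \<open>d = 0\<close>, then \<open>c = 0\<close> by the convention for
    division by zero, and the next identity reads 0 = 0.\<close>
  define c where "c = inner (x - p) d / inner d d"
  have c: "inner (x - p) d = c * inner d d"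
    by (cases "d = 0") (auto simp: c_def)
  have sub: "span B \<subseteq> span (insert b B)" by (rule span_mono) auto
  have "inner (x - (p + c *\<^sub>R d)) k = 0" if "k \<in> span (insert b B)" for k
  proof -
    obtain a where a: "k - a *\<^sub>R b \<in> span B"
      using \<open>k \<in> span (insert b B)\<close> by (auto simp: span_insert)
    \<comment> \<open>Trading \<open>b\<close> for \<open>d\<close> splits \<open>k\<close> into a
      vector of \<open>span B\<close> and a multiple of \<open>d\<close>, so orthogonality is
      checked on each summand.\<close>
    define l where "l = k - a *\<^sub>R b + a *\<^sub>R q"
    have l: "l \<in> span B" unfolding l_def using a q(1) by (intro span_add span_scale)
    have k: "k = l + a *\<^sub>R d" by (simp add: l_def d_def algebra_simps)
    have "inner ((x - p) - c *\<^sub>R d) k = 0"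
      unfolding k using p(2)[OF l] q(2)[OF l, folded d_def] c
      by (simp add: inner_diff_left[of _ "c *\<^sub>R d"] inner_add_right)
    then show ?thesis by (simp add: diff_diff_add)
  qed
  moreover have "p + c *\<^sub>R d \<in> span (insert b B)"
    unfolding d_def using p(1) q(1) sub by (intro span_add span_scale span_diff) (auto intro: span_base)
  ultimately show ?case by blast
qed

text \<open>Makes the \<open>THE\<close> in \<open>orth_proj\<close> accessible: the difference of
  two candidates lies in \<open>K\<close> and is orthogonal to itself. Later identities about
  projections are proved by exhibiting a candidate.\<close>

lemma orth_proj_eqI:
  assumes "subspace K" "p \<in> K" "\<And>k. k \<in> K \<Longrightarrow> inner (x - p) k = 0"
  shows "orth_proj K x = p"
  unfolding orth_proj_def
proof (rule the_equality)
  fix r assume r: "r \<in> K \<and> (\<forall>k\<in>K. inner (x - r) k = 0)"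
  have "r - p \<in> K" using r assms by (auto intro: subspace_diff)
  then have "inner (x - p) (r - p) = 0" "inner (x - r) (r - p) = 0" using r assms by auto
  then have "inner (r - p) (r - p) = 0" by (simp add: inner_diff_left)
  then show "r = p" by simp
qed (use assms in auto)

context
  fixes K B :: "'a::real_inner set"
  assumes fin: "finite B" and K: "K = span B"
begin

lemma orth_proj_in: "orth_proj K x \<in> K"
  and orth_proj_orth: "k \<in> K \<Longrightarrow> inner (x - orth_proj K x) k = 0"
proof -
  obtain p where p: "p \<in> K" "\<And>k. k \<in> K \<Longrightarrow> inner (x - p) k = 0"
    using orth_proj_exists[OF fin] K by blast
  then have "orth_proj K x = p" by (intro orth_proj_eqI) (auto simp: K)
  then show "orth_proj K x \<in> K" "k \<in> K \<Longrightarrow> inner (x - orth_proj K x) k = 0" using p by auto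
qed

lemma orth_proj_id: "x \<in> K \<Longrightarrow> orth_proj K x = x"
  by (rule orth_proj_eqI) (auto simp: K)

lemma norm_orth_proj_le: "norm (orth_proj K x) \<le> norm x"
proof -
  have "inner (x - orth_proj K x) (orth_proj K x) = 0"
    by (rule orth_proj_orth[OF orth_proj_in])
  then have "norm (orth_proj K x) ^ 2 = inner x (orth_proj K x)"
    by (simp add: inner_diff_left power2_norm_eq_inner)
  also have "\<dots> \<le> norm x * norm (orth_proj K x)" by (rule norm_cauchy_schwarz)
  finally show ?thesis by (cases "orth_proj K x = 0") (auto simp: power2_eq_square)
qed

lemma bounded_linear_orth_proj: "bounded_linear (orth_proj K)"
proof (rule bounded_linear_intro[where K=1])
  have sub: "subspace K" by (simp add: K)
  show "orth_proj K (x + y) = orth_proj K x + orth_proj K y" for x y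
  proof (rule orth_proj_eqI[OF sub])
    fix k assume "k \<in> K"
    then show "inner (x + y - (orth_proj K x + orth_proj K y)) k = 0"
      using orth_proj_orth[of k x] orth_proj_orth[of k y]
      by (simp add: inner_diff_left inner_add_left)
  qed (intro subspace_add sub orth_proj_in)
  show "orth_proj K (c *\<^sub>R x) = c *\<^sub>R orth_proj K x" for c x
  proof (rule orth_proj_eqI[OF sub])
    fix k assume "k \<in> K"
    then show "inner (c *\<^sub>R x - c *\<^sub>R orth_proj K x) k = 0"
      using orth_proj_orth[of k x] by (simp add: inner_diff_left)
  qed (intro subspace_scale sub orth_proj_in)
qed (simp add: norm_orth_proj_le)

end

section \<open>Semigroups and eigenvectors\<close>

text \<open>Linearity of \<open>L\<close> is not part of \<open>is_generator\<close>. It comes from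
  uniqueness of the limit of difference quotients, which also puts \<open>c *\<^sub>R x\<close> into
  \<open>D\<close>.\<close>

lemma is_generator_scaleR:
  assumes "is_generator S D L" "x \<in> D"
  shows "L (c *\<^sub>R x) = c *\<^sub>R L x"
proof -
  have "((\<lambda>h. (S h x - x) /\<^sub>R h) \<longlongrightarrow> L x) (at_right 0)"
    using assms unfolding is_generator_def by blast
  from tendsto_scaleR[OF tendsto_const[of c] this]
  have lim: "((\<lambda>h. (S h (c *\<^sub>R x) - c *\<^sub>R x) /\<^sub>R h) \<longlongrightarrow> c *\<^sub>R L x) (at_right 0)"
    by (simp add: blinfun.scaleR_right algebra_simps)
  then have "c *\<^sub>R x \<in> D" using assms unfolding is_generator_def by blast
  then have "((\<lambda>h. (S h (c *\<^sub>R x) - c *\<^sub>R x) /\<^sub>R h) \<longlongrightarrow> L (c *\<^sub>R x)) (at_right 0)"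
    using assms unfolding is_generator_def by blast
  from tendsto_unique[OF trivial_limit_at_right_real this lim] show ?thesis .
qed

text \<open>Telescoping \<open>e\<^bsup>-\<mu>s\<^esup> S s v\<close> over \<open>n\<close> steps of length \<open>t / n\<close>, each contributing \<open>o(t / n)\<close>,
  avoids two-sided differentiability of the orbit.\<close>

lemma c0_semigroup_eigenvector:
  assumes S: "c0_semigroup S" and gen: "is_generator S D L"
    and bound: "\<And>t. t \<ge> 0 \<Longrightarrow> norm (S t) \<le> M * exp (\<omega> * t)" and "M \<ge> 0" "\<omega> \<ge> 0"
    and v: "v \<in> D" "L v = \<mu> *\<^sub>R v" and t: "t \<ge> 0"
  shows "S t v = exp (\<mu> * t) *\<^sub>R v"
proof (cases "t = 0")
  case True
  then show ?thesis using S by (simp add: c0_semigroup_def)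
next
  case False
  then have tp: "t > 0" using t by simp
  define w where "w = (\<lambda>s. exp (- \<mu> * s) *\<^sub>R S s v)"
  define B where "B = exp (\<bar>\<mu>\<bar> * t) * (M * exp (\<omega> * t))"
  have B: "B \<ge> 0" using \<open>M \<ge> 0\<close> by (simp add: B_def)
  have add: "S (r + s) v = S r (S s v)" if "r \<ge> 0" "s \<ge> 0" for r s
    using S that by (simp add: c0_semigroup_def)
  \<comment> \<open>By the semigroup law every increment of \<open>w\<close> is the first one
    transported by exp(-\<mu> s) S(s), whose norm is at most \<open>B\<close> for s in
    [0, t].\<close>
  have step: "norm (w (s + h) - w s) \<le> B * norm (w h - v)" if "0 \<le> s" "s \<le> t" "0 \<le> h" for s h
  proof -
    have "w (s + h) - w s = exp (- \<mu> * s) *\<^sub>R S s (w h - v)"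
      unfolding w_def add[OF that(1,3)]
      by (simp add: blinfun.diff_right blinfun.scaleR_right scaleR_diff_right
          exp_add[symmetric] distrib_left)
    then have "norm (w (s + h) - w s) = exp (- \<mu> * s) * norm (S s (w h - v))" by simp
    also have "\<dots> \<le> exp (\<bar>\<mu>\<bar> * t) * (norm (S s) * norm (w h - v))"
    proof (intro mult_mono norm_blinfun)
      have "- \<mu> * s \<le> \<bar>\<mu>\<bar> * s" using that by (intro mult_right_mono) auto
      also have "\<dots> \<le> \<bar>\<mu>\<bar> * t" using that by (intro mult_left_mono) auto
      finally show "exp (- \<mu> * s) \<le> exp (\<bar>\<mu>\<bar> * t)" by simp
    qed auto
    also have "\<dots> \<le> exp (\<bar>\<mu>\<bar> * t) * ((M * exp (\<omega> * t)) * norm (w h - v))"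
    proof (intro mult_left_mono mult_right_mono)
      have "norm (S s) \<le> M * exp (\<omega> * s)" using bound that by simp
      also have "\<dots> \<le> M * exp (\<omega> * t)"
        using that \<open>M \<ge> 0\<close> \<open>\<omega> \<ge> 0\<close> by (intro mult_left_mono) (auto intro: mult_left_mono)
      finally show "norm (S s) \<le> M * exp (\<omega> * t)" .
    qed auto
    finally show ?thesis by (simp add: B_def mult_ac)
  qed
  have w0: "w 0 = v" using S by (simp add: w_def c0_semigroup_def)
  have tele: "norm (w (real k * h) - v) \<le> real k * (B * norm (w h - v))"
    if "h \<ge> 0" "real k * h \<le> t" for k h
    using that
  proof (induction k)
    case 0
    then show ?case by (simp add: w0)
  next
    case (Suc k)
    have le: "real k * h \<le> t" using Suc.prems by (simp add: algebra_simps)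
    have "norm (w (real (Suc k) * h) - v)
        \<le> norm (w (real k * h + h) - w (real k * h)) + norm (w (real k * h) - v)"
      using norm_triangle_ineq[of "w (real k * h + h) - w (real k * h)" "w (real k * h) - v"]
      by (simp add: algebra_simps)
    also have "\<dots> \<le> B * norm (w h - v) + real k * (B * norm (w h - v))"
      using step[of "real k * h" h] Suc le by (intro add_mono) auto
    finally show ?case by (simp add: algebra_simps)
  qed
  have d1: "((\<lambda>h. (S h v - v) /\<^sub>R h) \<longlongrightarrow> \<mu> *\<^sub>R v) (at_right 0)"
    using gen v unfolding is_generator_def by metis
  have d2: "((\<lambda>h. (exp (- \<mu> * h) - 1) / h) \<longlongrightarrow> - \<mu>) (at_right 0)"
  proof -
    have "((\<lambda>h. exp (- \<mu> * h)) has_field_derivative - \<mu>) (at 0)"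
      by (auto intro!: derivative_eq_intros)
    then show ?thesis
      by (simp add: has_field_derivative_iff filterlim_at_split)
  qed
  have d3: "((\<lambda>h. exp (- \<mu> * h)) \<longlongrightarrow> exp (- \<mu> * 0)) (at_right (0::real))"
    by (intro tendsto_intros)
  \<comment> \<open>Product rule for \<open>w\<close> at 0: the contributions \<mu> v and -\<mu> v
    cancel, so \<open>w\<close> has right derivative 0 there.\<close>
  note tendsto_add[OF tendsto_scaleR[OF d3 d1] tendsto_scaleR[OF d2 tendsto_const[of v]]]
  moreover have "exp (- \<mu> * h) *\<^sub>R ((S h v - v) /\<^sub>R h) + ((exp (- \<mu> * h) - 1) / h) *\<^sub>R v
      = (w h - v) /\<^sub>R h" for h
    by (simp add: w_def divide_inverse algebra_simps)
  ultimately have "((\<lambda>h. (w h - v) /\<^sub>R h) \<longlongrightarrow> 0) (at_right 0)" by simp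
  moreover have "filterlim (\<lambda>n. t / real (Suc n)) (at_right 0) sequentially"
    unfolding filterlim_at
  proof
    show "((\<lambda>n. t / real (Suc n)) \<longlongrightarrow> 0) sequentially"
      by (rule LIMSEQ_Suc) (rule lim_const_over_n)
  qed (use tp in auto)
  ultimately have "(\<lambda>n. (w (t / real (Suc n)) - v) /\<^sub>R (t / real (Suc n))) \<longlonglongrightarrow> 0"
    by (rule filterlim_compose)
  from tendsto_mult[OF tendsto_const[of "t * B"] tendsto_norm[OF this]]
  have lim: "(\<lambda>n. t * B * norm ((w (t / real (Suc n)) - v) /\<^sub>R (t / real (Suc n)))) \<longlonglongrightarrow> 0" by simp
  \<comment> \<open>\<open>tele\<close> with \<open>Suc n\<close> steps of length
    \<open>t / real (Suc n)\<close>. The number of steps times the step length is \<open>t\<close>,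
    so the bound is a fixed multiple of the vanishing difference quotient.\<close>
  have "norm (w t - v) \<le> t * B * norm ((w (t / real (Suc n)) - v) /\<^sub>R (t / real (Suc n)))" for n
  proof -
    have "norm ((w (t / real (Suc n)) - v) /\<^sub>R (t / real (Suc n)))
        = real (Suc n) * norm (w (t / real (Suc n)) - v) / t"
      unfolding norm_scaleR using tp by (simp add: field_simps)
    then show ?thesis using tele[of "t / real (Suc n)" "Suc n"] tp by (simp add: mult_ac)
  qed
  then have "norm (w t - v) \<le> 0"
    by (intro LIMSEQ_le_const[OF lim]) auto
  then have "exp (- \<mu> * t) *\<^sub>R S t v = v" by (simp add: w_def)
  then have "exp (\<mu> * t) *\<^sub>R (exp (- \<mu> * t) *\<^sub>R S t v) = exp (\<mu> * t) *\<^sub>R v" by simp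
  then show ?thesis by (simp add: exp_add[symmetric])
qed

text \<open>Moving \<open>L\<close> across the inner product gives (\<mu> - \<nu>)
  \<open>inner v w\<close> = 0. The disjunction allows for multiple eigenvalues.\<close>

lemma inner_eigenvectors:
  assumes "self_adjoint D L" "v \<in> D" "w \<in> D" "L v = \<mu> *\<^sub>R v" "L w = \<nu> *\<^sub>R w"
  shows "inner v w = 0 \<or> \<mu> = \<nu>"
proof -
  have "inner (L v) w = inner v (L w)"
    using assms unfolding self_adjoint_def is_adjoint_def by blast
  then show ?thesis using assms by auto
qed


section \<open>Integral estimates\<close>

text \<open>Integrating factor: \<open>g\<close>, the right-hand side of the hypothesis times exp(-k
  s), has derivative k exp(-k s) times the gap in the hypothesis, which is nonpositive; and
  \<open>g 0 = b\<close>.\<close>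

lemma gronwall:
  fixes f :: "real \<Rightarrow> real"
  assumes cont: "continuous_on {0..T} f" and "k \<ge> 0"
    and le: "\<And>t. t \<in> {0..T} \<Longrightarrow> f t \<le> b + k * integral {0..t} f" and t: "t \<in> {0..T}"
  shows "f t \<le> b * exp (k * t)"
proof -
  define g where "g s = (b + k * integral {0..s} f) * exp (- k * s)" for s
  have der: "((\<lambda>s. integral {0..s} f) has_real_derivative f s) (at s within {0..T})"
    if "s \<in> {0..T}" for s
    using integral_has_real_derivative[OF cont that] .
  have "g t \<le> g 0"
  proof (rule DERIV_nonpos_imp_decreasing_open[where f=g])
    fix s assume s: "0 < s" "s < t"
    have "((\<lambda>s. integral {0..s} f) has_real_derivative f s) (at s)"
      using der[of s] s t by (simp add: at_within_Icc_at)
    then have "(g has_real_derivative k * f s * exp (- k * s)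
        + (b + k * integral {0..s} f) * (exp (- k * s) * - k)) (at s)"
      unfolding g_def by (auto intro!: derivative_eq_intros)
    moreover have "k * f s * exp (- k * s) + (b + k * integral {0..s} f) * (exp (- k * s) * - k)
        = k * exp (- k * s) * (f s - (b + k * integral {0..s} f))"
      by (simp add: algebra_simps)
    moreover have "\<dots> \<le> 0"
      using le[of s] s t \<open>k \<ge> 0\<close> by (intro mult_nonneg_nonpos) auto
    ultimately show "\<exists>y. (g has_real_derivative y) (at s) \<and> y \<le> 0" by metis
  next
    have "continuous_on {0..T} (\<lambda>s. integral {0..s} f)"
      by (rule DERIV_continuous_on[OF der])
    then have "continuous_on {0..t} (\<lambda>s. integral {0..s} f)"
      using t by (auto elim: continuous_on_subset)
    then show "continuous_on {0..t} g"
      unfolding g_def by (intro continuous_intros)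
  qed (use t in auto)
  then have "g t * exp (k * t) \<le> b * exp (k * t)" by (simp add: g_def)
  moreover have "g t * exp (k * t) = b + k * integral {0..t} f"
    by (simp add: g_def mult.assoc exp_add[symmetric])
  ultimately show ?thesis using le[OF t] by simp
qed

text \<open>Cauchy-Schwarz against the constant 1, read off from the nonnegative variance of
  \<open>g\<close> about its mean \<open>I / T\<close>: expanding the square gives I^2 \<le> T
  Q.\<close>

lemma integral_le_L2:
  assumes cont: "continuous_on {0..T} f" and "T > 0"
  shows "integral {0..T} (\<lambda>s. norm (f s)) \<le> sqrt T * Lp_norm 2 0 T f"
proof -
  define g where "g s = norm (f s)" for s
  have g: "continuous_on {0..T} g" unfolding g_def by (intro continuous_intros cont)
  have int: "h integrable_on {0..T}" if "continuous_on {0..T} h" for h :: "real \<Rightarrow> real"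
    using that by (rule integrable_continuous_real)
  define I where "I = integral {0..T} g"
  define Q where "Q = integral {0..T} (\<lambda>s. (g s)\<^sup>2)"
  have ig: "g integrable_on {0..T}" "(\<lambda>s. (g s)\<^sup>2) integrable_on {0..T}"
    by (intro int continuous_intros g)+
  have "0 \<le> integral {0..T} (\<lambda>s. (g s - I / T)\<^sup>2)"
    by (intro integral_nonneg int continuous_intros g) auto
  also have "(\<lambda>s. (g s - I / T)\<^sup>2) = (\<lambda>s. ((g s)\<^sup>2 - (2 * I / T) * g s) + (I / T)\<^sup>2)"
    by (auto simp: power2_diff field_simps)
  also have "integral {0..T} \<dots> = Q - (2 * I / T) * I + T * (I / T)\<^sup>2"
  proof -
    have m: "(\<lambda>s. (2 * I / T) * g s) integrable_on {0..T}"
      by (intro int continuous_intros g)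
    have "integral {0..T} (\<lambda>s. ((g s)\<^sup>2 - (2 * I / T) * g s) + (I / T)\<^sup>2)
        = integral {0..T} (\<lambda>s. (g s)\<^sup>2 - (2 * I / T) * g s) + integral {0..T} (\<lambda>s. (I / T)\<^sup>2)"
      by (intro integral_add integrable_diff ig m) auto
    also have "integral {0..T} (\<lambda>s. (g s)\<^sup>2 - (2 * I / T) * g s) = Q - (2 * I / T) * I"
      unfolding integral_diff[OF ig(2) m] integral_mult_right by (simp add: Q_def I_def)
    finally show ?thesis using \<open>T > 0\<close> by simp
  qed
  finally have "0 \<le> (Q - (2 * I / T) * I + T * (I / T)\<^sup>2) * T"
    using \<open>T > 0\<close> by simp
  then have "I\<^sup>2 \<le> T * Q" using \<open>T > 0\<close> by (simp add: field_simps power2_eq_square)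
  then have "I \<le> sqrt (T * Q)" by (rule real_le_rsqrt)
  moreover have "Lp_norm 2 0 T f = sqrt Q"
  proof -
    have "integrable (lebesgue_on {0..T}) (\<lambda>s. (g s)\<^sup>2)"
      by (intro continuous_imp_integrable_real continuous_intros g)
    then have "(\<integral>s. (g s)\<^sup>2 \<partial>lebesgue_on {0..T}) = Q"
      unfolding Q_def by (rule lebesgue_integral_eq_integral) auto
    moreover have "Q \<ge> 0" unfolding Q_def by (intro integral_nonneg ig) auto
    ultimately show ?thesis by (simp add: Lp_norm_def g_def powr_half_sqrt)
  qed
  ultimately show ?thesis by (simp add: I_def g_def[abs_def] real_sqrt_mult)
qed

section \<open>Projected solutions and costs\<close>

text \<open>Galerkin error in abstract form, \<open>P\<close> being the projector and
  \<open>A\<close> the Galerkin flow. Projecting the formula for \<open>y\<close> and commuting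
  \<open>P\<close> with the flow leaves only the difference of the \<open>F\<close> terms, to which
  Gronwall applies.\<close>

lemma projected_mild_solution_error:
  fixes S :: "real \<Rightarrow> 'h::{real_inner, banach, second_countable_topology} \<Rightarrow>\<^sub>L 'h"
  assumes P: "bounded_linear P" "\<And>z. norm (P z) \<le> norm z"
    and comm: "\<And>t z. t \<ge> 0 \<Longrightarrow> A t (P z) = P (S t z)"
    and SB: "\<And>t. t \<in> {0..T} \<Longrightarrow> norm (S t) \<le> B"
    and y: "mild_solution (\<lambda>t. blinfun_apply (S t)) F g 0 T x y"
    and yP: "mild_solution A (\<lambda>z. P (F z)) (\<lambda>s. P (g s)) 0 T (P x) yP"
    and F: "l-lipschitz_on (cball 0 r) F"
    and r: "\<And>s. s \<in> {0..T} \<Longrightarrow> norm (y s) \<le> r" "\<And>s. s \<in> {0..T} \<Longrightarrow> norm (yP s) \<le> r"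
    and t: "t \<in> {0..T}"
  shows "norm (P (y t) - yP t)
    \<le> B * l * integral {0..T} (\<lambda>s. norm (y s - P (y s))) * exp (B * l * T)"
proof -
  have B: "B \<ge> 0" using SB[OF t] norm_ge_zero[of "S t"] by linarith
  have l: "l \<ge> 0" using F by (rule lipschitz_on_nonneg)
  have cy: "continuous_on {0..T} y" and cyP: "continuous_on {0..T} yP"
    using y yP by (auto simp: mild_solution_def)
  have cPy: "continuous_on {0..T} (\<lambda>s. P (y s))"
    by (rule bounded_linear.continuous_on[OF P(1) cy])
  define a where "a s = norm (y s - P (y s))" for s
  define w where "w s = norm (P (y s) - yP s)" for s
  have ca: "continuous_on {0..T} a" unfolding a_def by (intro continuous_intros cy cPy)
  have cw: "continuous_on {0..T} w" unfolding w_def by (intro continuous_intros cPy cyP)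
  have "w t \<le> B * l * integral {0..T} a + B * l * integral {0..t} w" if t: "t \<in> {0..T}" for t
  proof -
    have sub: "{0..t} \<subseteq> {0..T}" using t by auto
    let ?M = "lebesgue_on {0..t}"
    have i1: "integrable ?M (\<lambda>s. S (t - s) (F (y s)))" and i2: "integrable ?M (\<lambda>s. S (t - s) (g s))"
      and yt: "y t = S t x + (\<integral>s. S (t - s) (F (y s)) \<partial>?M) + (\<integral>s. S (t - s) (g s) \<partial>?M)"
      using y t by (auto simp: mild_solution_def)
    have j1: "integrable ?M (\<lambda>s. A (t - s) (P (F (yP s))))"
      and yPt: "yP t = A t (P x) + (\<integral>s. A (t - s) (P (F (yP s))) \<partial>?M)
          + (\<integral>s. A (t - s) (P (g s)) \<partial>?M)"
      using yP t by (auto simp: mild_solution_def)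
    \<comment> \<open>The control terms of \<open>P (y t)\<close> and \<open>yP t\<close> coincide,
      so the control disappears from the estimate.\<close>
    have "P (\<integral>s. S (t - s) (g s) \<partial>?M) = (\<integral>s. P (S (t - s) (g s)) \<partial>?M)"
      by (rule integral_bounded_linear[OF P(1) i2, symmetric])
    also have "\<dots> = (\<integral>s. A (t - s) (P (g s)) \<partial>?M)"
      by (intro Bochner_Integration.integral_cong) (auto simp: comm)
    finally have "P (y t) - yP t = (\<integral>s. P (S (t - s) (F (y s))) \<partial>?M)
        - (\<integral>s. A (t - s) (P (F (yP s))) \<partial>?M)"
      using t comm[of t x] integral_bounded_linear[OF P(1) i1]
      unfolding yt yPt by (simp add: linear_simps[OF P(1)])
    also have "\<dots> = (\<integral>s. P (S (t - s) (F (y s))) - A (t - s) (P (F (yP s))) \<partial>?M)"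
      by (intro Bochner_Integration.integral_diff[symmetric] integrable_bounded_linear[OF P(1) i1] j1)
    finally have w_eq: "w t = norm (\<integral>s. P (S (t - s) (F (y s))) - A (t - s) (P (F (yP s))) \<partial>?M)"
      by (simp add: w_def)
    have caw: "continuous_on {0..t} (\<lambda>s. B * l * (a s + w s))"
      by (intro continuous_intros continuous_on_subset[OF ca sub] continuous_on_subset[OF cw sub])
    have "w t \<le> (\<integral>s. B * l * (a s + w s) \<partial>?M)"
      unfolding w_eq
    proof (rule Bochner_Integration.integral_norm_bound_integral)
      show "integrable ?M (\<lambda>s. B * l * (a s + w s))"
        by (rule continuous_imp_integrable_real[OF caw])
      fix s assume "s \<in> space ?M"
      then have s: "s \<in> {0..t}" by simp
      have "P (S (t - s) (F (y s))) - A (t - s) (P (F (yP s))) = P (S (t - s) (F (y s) - F (yP s)))"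
        using s by (simp add: comm linear_simps[OF P(1)] blinfun.diff_right)
      also have "norm \<dots> \<le> norm (S (t - s) (F (y s) - F (yP s)))" by (rule P(2))
      also have "\<dots> \<le> norm (S (t - s)) * norm (F (y s) - F (yP s))" by (rule norm_blinfun)
      \<comment> \<open>Both trajectories stay in the ball on which \<open>F\<close> is
        \<open>l\<close>-Lipschitz. Their distance is then split at \<open>P (y s)\<close> into
        projection error \<open>a\<close> and the quantity \<open>w\<close> to be bounded.\<close>
      also have "\<dots> \<le> B * (l * norm (y s - yP s))"
      proof (intro mult_mono)
        show "norm (S (t - s)) \<le> B" using s t by (intro SB) auto
        show "norm (F (y s) - F (yP s)) \<le> l * norm (y s - yP s)"
          using lipschitz_onD[OF F, of "y s" "yP s"] r[of s] s t by (auto simp: dist_norm)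
      qed (use B in auto)
      also have "\<dots> \<le> B * (l * (a s + w s))"
        using B l norm_triangle_ineq[of "y s - P (y s)" "P (y s) - yP s"]
        by (intro mult_left_mono) (auto simp: a_def w_def)
      finally show "norm (P (S (t - s) (F (y s))) - A (t - s) (P (F (yP s)))) \<le> B * l * (a s + w s)"
        by (simp add: mult.assoc)
    qed (intro Bochner_Integration.integrable_diff integrable_bounded_linear[OF P(1) i1] j1)
    also have "\<dots> = integral {0..t} (\<lambda>s. B * l * (a s + w s))"
      by (rule lebesgue_integral_eq_integral[OF continuous_imp_integrable_real[OF caw]]) auto
    also have "\<dots> = B * l * integral {0..t} a + B * l * integral {0..t} w"
    proof -
      have "integral {0..t} (\<lambda>s. a s + w s) = integral {0..t} a + integral {0..t} w"
        by (intro integral_add integrable_continuous_real continuous_on_subset[OF ca sub]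
            continuous_on_subset[OF cw sub])
      then show ?thesis unfolding integral_mult_right by (simp add: distrib_left)
    qed
    \<comment> \<open>Enlarging the interval makes this term independent of \<open>t\<close>, as the
      constant in Gronwall has to be.\<close>
    also have "integral {0..t} a \<le> integral {0..T} a"
      by (intro integral_subset_le sub integrable_continuous_real ca continuous_on_subset[OF ca sub])
         (auto simp: a_def)
    finally show ?thesis using B l by (simp add: mult_left_mono)
  qed
  then have "w t \<le> B * l * integral {0..T} a * exp (B * l * t)"
    using gronwall[OF cw] B l t by simp
  also have "\<dots> \<le> B * l * integral {0..T} a * exp (B * l * T)"
  proof (rule mult_left_mono)
    show "exp (B * l * t) \<le> exp (B * l * T)" using B l t by (simp add: mult_left_mono)
    have "integral {0..T} a \<ge> 0"
      by (intro integral_nonneg integrable_continuous_real ca) (auto simp: a_def)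
    then show "0 \<le> B * l * integral {0..T} a" using B l by simp
  qed
  finally show ?thesis by (simp add: w_def a_def[abs_def])
qed

text \<open>The control cost is common to \<open>J y\<close> and \<open>J y'\<close>, while the
  \<open>G\<close> integrals are finite because the trajectories are continuous. So both costs are
  finite or infinite together, and in the finite case the control cost cancels.\<close>

lemma cost_difference_le:
  fixes y y' :: "real \<Rightarrow> 'h::real_normed_vector" and E :: "'v::{second_countable_topology, real_normed_vector} \<Rightarrow> real"
  assumes y: "continuous_on {0..T} y" "continuous_on {0..T} y'"
    and r: "\<And>s. s \<in> {0..T} \<Longrightarrow> norm (y s) \<le> r" "\<And>s. s \<in> {0..T} \<Longrightarrow> norm (y' s) \<le> r"
    and G: "\<And>z. G z \<ge> 0" "l-lipschitz_on (cball 0 r) G"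
    and E: "\<And>v. E v \<ge> 0" "continuous_on UNIV E"
    and u: "u \<in> borel_measurable (lebesgue_on {0..T})"
  defines "J \<equiv> \<lambda>y. \<integral>\<^sup>+ s. ennreal (G (y s) + E (u s)) \<partial>lebesgue_on {0..T}"
  shows "J y < \<infinity> \<longleftrightarrow> J y' < \<infinity>"
    and "J y < \<infinity> \<Longrightarrow>
      \<bar>enn2real (J y) - enn2real (J y')\<bar> \<le> l * integral {0..T} (\<lambda>s. norm (y s - y' s))"
proof -
  let ?M = "lebesgue_on {0..T}"
  have Eu: "(\<lambda>s. E (u s)) \<in> borel_measurable ?M"
    using borel_measurable_continuous_onI[OF E(2)] u by (rule measurable_compose_rev)
  have split: "continuous_on {0..T} (\<lambda>s. G (z s)) \<and>
      J z = ennreal (integral {0..T} (\<lambda>s. G (z s))) + (\<integral>\<^sup>+ s. ennreal (E (u s)) \<partial>?M)"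
    if z: "continuous_on {0..T} z" "\<And>s. s \<in> {0..T} \<Longrightarrow> norm (z s) \<le> r" for z
  proof
    show c: "continuous_on {0..T} (\<lambda>s. G (z s))"
      by (rule continuous_on_compose2[OF lipschitz_on_continuous_on[OF G(2)] z(1)]) (use z(2) in auto)
    have int: "integrable ?M (\<lambda>s. G (z s))" by (rule continuous_imp_integrable_real[OF c])
    have "J z = (\<integral>\<^sup>+ s. ennreal (G (z s)) + ennreal (E (u s)) \<partial>?M)"
      unfolding J_def using G(1) E(1) by simp
    also have "\<dots> = (\<integral>\<^sup>+ s. ennreal (G (z s)) \<partial>?M) + (\<integral>\<^sup>+ s. ennreal (E (u s)) \<partial>?M)"
      using int Eu by (intro nn_integral_add) auto
    also have "(\<integral>\<^sup>+ s. ennreal (G (z s)) \<partial>?M) = ennreal (\<integral>s. G (z s) \<partial>?M)"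
      using int G(1) by (intro nn_integral_eq_integral) auto
    also have "(\<integral>s. G (z s) \<partial>?M) = integral {0..T} (\<lambda>s. G (z s))"
      using int by (rule lebesgue_integral_eq_integral) auto
    finally show "J z = ennreal (integral {0..T} (\<lambda>s. G (z s))) + (\<integral>\<^sup>+ s. ennreal (E (u s)) \<partial>?M)" .
  qed
  note s1 = split[OF y(1) r(1)] and s2 = split[OF y(2) r(2)]
  show "J y < \<infinity> \<longleftrightarrow> J y' < \<infinity>" using s1 s2 by (simp add: ennreal_add_less_top)
  assume "J y < \<infinity>"
  then have "(\<integral>\<^sup>+ s. ennreal (E (u s)) \<partial>?M) < \<infinity>" using s1 by (simp add: ennreal_add_less_top)
  then obtain c where c: "c \<ge> 0" "(\<integral>\<^sup>+ s. ennreal (E (u s)) \<partial>?M) = ennreal c"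
    by (metis infinity_ennreal_def less_top_ennreal)
  have i: "(\<lambda>s. G (y s)) integrable_on {0..T}" "(\<lambda>s. G (y' s)) integrable_on {0..T}"
    using s1 s2 by (auto intro: integrable_continuous_real)
  then have nn: "integral {0..T} (\<lambda>s. G (y s)) \<ge> 0" "integral {0..T} (\<lambda>s. G (y' s)) \<ge> 0"
    using G(1) by (auto intro!: integral_nonneg)
  have "enn2real (J y) - enn2real (J y') = integral {0..T} (\<lambda>s. G (y s)) - integral {0..T} (\<lambda>s. G (y' s))"
    using s1 s2 c nn by (simp add: ennreal_plus[symmetric] del: ennreal_plus)
  also have "\<dots> = integral {0..T} (\<lambda>s. G (y s) - G (y' s))"
    by (rule integral_diff[OF i, symmetric])
  also have "\<bar>\<dots>\<bar> \<le> integral {0..T} (\<lambda>s. l * norm (y s - y' s))"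
  proof -
    have "norm (integral {0..T} (\<lambda>s. G (y s) - G (y' s))) \<le> integral {0..T} (\<lambda>s. l * norm (y s - y' s))"
    proof (rule Henstock_Kurzweil_Integration.integral_norm_bound_integral)
      fix s assume "s \<in> {0..T}"
      then show "norm (G (y s) - G (y' s)) \<le> l * norm (y s - y' s)"
        using lipschitz_onD[OF G(2), of "y s" "y' s"] r[of s] by (auto simp: dist_norm)
    qed (intro integrable_diff i integrable_continuous_real continuous_intros y)+
    then show ?thesis by simp
  qed
  finally show "\<bar>enn2real (J y) - enn2real (J y')\<bar> \<le> l * integral {0..T} (\<lambda>s. norm (y s - y' s))"
    by simp
qed

section \<open>Selected solutions and admissible controls\<close>

lemma uniquely_solvable_someI: "uniquely_solvable a b P \<Longrightarrow> P (SOME y. P y)"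
  unfolding uniquely_solvable_def by (erule conjunct1[THEN someI_ex[of P]])

lemma admissible_from_0: "admissible_from q U 0 T = admissible q U T"
proof -
  have "u \<in> admissible q U T" if v: "v \<in> admissible q U T" and eq: "\<forall>s\<in>{0..T}. u s = v s" for u v
  proof -
    have "u \<in> borel_measurable (lebesgue_on {0..T}) \<longleftrightarrow> v \<in> borel_measurable (lebesgue_on {0..T})"
      by (rule measurable_cong) (use eq in auto)
    moreover have "integrable (lebesgue_on {0..T}) (\<lambda>s. norm (u s) powr q)
        \<longleftrightarrow> integrable (lebesgue_on {0..T}) (\<lambda>s. norm (v s) powr q)"
      by (rule Bochner_Integration.integrable_cong) (use eq in auto)
    moreover have "(AE s in lebesgue_on {0..T}. u s \<in> U) \<longleftrightarrow> (AE s in lebesgue_on {0..T}. v s \<in> U)"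
      by (rule AE_cong) (use eq in auto)
    ultimately show ?thesis using v by (simp add: admissible_def)
  qed
  then show ?thesis by (auto simp: admissible_from_def)
qed

text \<open>[0, T] has positive measure, so a control with values a.e. in \<open>U\<close> forces
  \<open>U\<close> to be nonempty. The constant control serves later to show that the minimal cost
  is finite.\<close>

lemma admissible_const:
  assumes "u \<in> admissible q U T" "T > 0"
  shows "\<exists>v. (\<lambda>_. v) \<in> admissible q U T"
proof -
  have "emeasure (lebesgue_on {0..T}) {0..T} = ennreal T"
    using assms(2) by (simp add: emeasure_restrict_space)
  then have "\<not> (AE s in lebesgue_on {0..T}. False)"
    using assms(2) by (simp add: eventually_False ae_filter_eq_bot_iff)
  moreover have "AE s in lebesgue_on {0..T}. u s \<in> U" using assms(1) by (simp add: admissible_def)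
  ultimately obtain v where "v \<in> U" by (metis (mono_tags, lifting) eventually_mono)
  moreover have "integrable (lebesgue_on {0..T}) (\<lambda>s. norm v powr q)"
    by (intro continuous_imp_integrable_real continuous_on_const)
  ultimately show ?thesis by (auto simp: admissible_def)
qed

section \<open>Galerkin flows\<close>

text \<open>The hypothesis covers all multiples of \<open>v\<close> because \<open>A\<close> is an
  arbitrary function and its iterates run through \<mu>^n v. The series then reduces to the scalar
  exponential.\<close>

lemma exp_op_eigenvector:
  assumes "\<And>c. A (c *\<^sub>R v) = (\<mu> * c) *\<^sub>R v"
  shows "exp_op A t v = exp (\<mu> * t) *\<^sub>R v"
proof -
  have pow: "(A ^^ n) v = \<mu> ^ n *\<^sub>R v" for n
    by (induction n) (simp_all add: assms)
  have "exp_op A t v = (\<Sum>n. ((\<mu> * t) ^ n /\<^sub>R fact n) *\<^sub>R v)"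
    unfolding exp_op_def by (simp add: pow power_mult_distrib divide_inverse mult_ac)
  also have "\<dots> = exp (\<mu> * t) *\<^sub>R v"
    unfolding exp_def by (rule suminf_scaleR_left[symmetric, OF summable_exp_generic])
  finally show ?thesis .
qed

context
  fixes S :: "real \<Rightarrow> 'h::{real_inner, banach} \<Rightarrow>\<^sub>L 'h"
    and D :: "'h set" and L :: "'h \<Rightarrow> 'h" and M \<omega> :: real
    and H :: "nat \<Rightarrow> 'h set" and e :: "nat \<Rightarrow> 'h"
  assumes semigroup: "c0_semigroup S" "is_generator S D L"
    and growth: "M \<ge> 0" "\<omega> \<ge> 0" "\<And>t. t \<ge> 0 \<Longrightarrow> norm (S t) \<le> M * exp (\<omega> * t)"
    and self_adj: "self_adjoint D L"
    and eigen: "\<And>k. k \<ge> 1 \<Longrightarrow> e k \<in> D \<and> (\<exists>\<mu>. L (e k) = \<mu> *\<^sub>R e k)"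
    and H: "\<And>N. N \<ge> 1 \<Longrightarrow> H N = span (e ` {1..N})"
begin

lemma semigroup_eigen:
  assumes "k \<ge> 1"
  obtains \<mu> where "L (e k) = \<mu> *\<^sub>R e k" "\<And>t. t \<ge> 0 \<Longrightarrow> S t (e k) = exp (\<mu> * t) *\<^sub>R e k"
proof -
  obtain \<mu> where \<mu>: "L (e k) = \<mu> *\<^sub>R e k" using eigen[OF assms] by blast
  show ?thesis
    by (rule that[OF \<mu>], rule c0_semigroup_eigenvector[OF semigroup growth(3,1,2)])
       (use eigen[OF assms] \<mu> in auto)
qed

lemma semigroup_eigen_span:
  assumes "N \<ge> 1" "t \<ge> 0" "z \<in> H N"
  shows "S t z \<in> H N"
  using assms(3) unfolding H[OF assms(1)]
proof (induction rule: span_induct_alt)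
  case base
  then show ?case by (simp add: span_zero)
next
  case (step c v z)
  then obtain k where k: "v = e k" "k \<in> {1..N}" by auto
  obtain \<mu> where "S t (e k) = exp (\<mu> * t) *\<^sub>R e k"
    using semigroup_eigen[of k] k assms(2) by auto
  then have "S t v \<in> span (e ` {1..N})" using k by (simp add: span_scale span_base)
  then show ?case using step by (simp add: blinfun.add_right blinfun.scaleR_right span_add span_scale)
qed

text \<open>A weak substitute for self-adjointness of \<open>S t\<close>: the identity is checked on
  the eigenvectors, extended linearly to each \<open>H N\<close>, and carried to all
  \<open>z\<close> by density.\<close>

lemma inner_semigroup_eigen:
  assumes dense: "(\<lambda>N. orth_proj (H N) z) \<longlonglongrightarrow> z" and "k \<ge> 1" "t \<ge> 0"
    and \<mu>: "L (e k) = \<mu> *\<^sub>R e k"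
  shows "inner (S t z) (e k) = exp (\<mu> * t) * inner z (e k)"
proof -
  \<comment> \<open>Either \<open>e j\<close> and \<open>e k\<close> are orthogonal and both sides
    vanish, or their eigenvalues agree.\<close>
  have gen: "inner (S t (e j)) (e k) = exp (\<mu> * t) * inner (e j) (e k)" if "j \<ge> 1" for j
  proof -
    obtain \<nu> where "L (e j) = \<nu> *\<^sub>R e j" "S t (e j) = exp (\<nu> * t) *\<^sub>R e j"
      by (rule semigroup_eigen[OF \<open>j \<ge> 1\<close>]) (use \<open>t \<ge> 0\<close> in blast)
    then show ?thesis
      using inner_eigenvectors[OF self_adj _ _ _ \<mu>, of "e j" \<nu>] eigen[of j] eigen[of k] that assms(2)
      by auto
  qed
  have span: "inner (S t w) (e k) = exp (\<mu> * t) * inner w (e k)" if "w \<in> H N" "N \<ge> 1" for w N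
    using that(1) unfolding H[OF that(2)]
  proof (induction rule: span_induct_alt)
    case base
    then show ?case by simp
  next
    case (step c v w)
    then show ?case
      using gen by (auto simp: blinfun.add_right blinfun.scaleR_right inner_add_left algebra_simps)
  qed
  have l1: "(\<lambda>N. inner (S t (orth_proj (H N) z)) (e k)) \<longlonglongrightarrow> inner (S t z) (e k)"
    by (intro tendsto_intros dense)
  have l2: "(\<lambda>N. exp (\<mu> * t) * inner (orth_proj (H N) z) (e k)) \<longlonglongrightarrow> exp (\<mu> * t) * inner z (e k)"
    by (intro tendsto_intros dense)
  \<comment> \<open>Only N \<ge> 1 is covered, since nothing is assumed about
    \<open>H 0\<close>.\<close>
  have ev: "\<forall>\<^sub>F N in sequentially. inner (S t (orth_proj (H N) z)) (e k)
      = exp (\<mu> * t) * inner (orth_proj (H N) z) (e k)"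
    using eventually_ge_at_top[of 1]
  proof eventually_elim
    case (elim N)
    then show ?case by (intro span[of _ N] orth_proj_in[OF _ H]) auto
  qed
  have "(\<lambda>N. exp (\<mu> * t) * inner (orth_proj (H N) z) (e k)) \<longlonglongrightarrow> inner (S t z) (e k)"
    by (rule Lim_transform_eventually[OF l1 ev])
  then show ?thesis using l2 by (rule LIMSEQ_unique)
qed

text \<open>By invariance \<open>S t (orth_proj (H N) z)\<close> is a candidate in
  \<open>H N\<close>. The residual \<open>z - orth_proj (H N) z\<close> has zero coefficient along
  each \<open>e j\<close> with j \<le> N, and the flow only multiplies such coefficients by an
  exponential.\<close>

lemma orth_proj_semigroup:
  assumes dense: "\<And>z. (\<lambda>N. orth_proj (H N) z) \<longlonglongrightarrow> z" and N: "N \<ge> 1" and t: "t \<ge> 0"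
  shows "orth_proj (H N) (S t z) = S t (orth_proj (H N) z)"
proof (rule orth_proj_eqI)
  note P = orth_proj_in[OF _ H[OF N]] orth_proj_orth[OF _ H[OF N]]
  show "subspace (H N)" by (simp add: H[OF N])
  show "S t (orth_proj (H N) z) \<in> H N" using semigroup_eigen_span[OF N t] P(1) by simp
  fix k assume "k \<in> H N"
  then show "inner (S t z - S t (orth_proj (H N) z)) k = 0"
    unfolding H[OF N]
  proof (induction rule: span_induct_alt)
    case base
    then show ?case by simp
  next
    case (step c v w)
    then obtain j where j: "v = e j" "j \<in> {1..N}" by auto
    then have "e j \<in> H N" by (simp add: H[OF N] span_base)
    then have "inner (z - orth_proj (H N) z) (e j) = 0" using P(2) by simp
    moreover obtain \<mu> where "L (e j) = \<mu> *\<^sub>R e j" using eigen[of j] j by auto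
    ultimately have "inner (S t (z - orth_proj (H N) z)) (e j) = 0"
      using inner_semigroup_eigen[OF dense, of j t \<mu>] j t by simp
    then show ?case using step j
      by (simp add: H[OF N] blinfun.diff_right inner_add_right)
  qed
qed

text \<open>\<open>exp_op\<close> is a pointwise series, so its linearity in \<open>z\<close> is not
  immediate. The bounded operator \<open>R\<close>, later the extended semigroup of hypothesis (a),
  supplies it, and agreement on the eigenvectors passes to their span.\<close>

lemma exp_galerkin_op:
  fixes R :: "'h \<Rightarrow>\<^sub>L 'h"
  assumes N: "N \<ge> 1" and t: "t \<ge> 0" and z: "z \<in> H N"
    and R: "\<And>z. z \<in> H N \<Longrightarrow> R z = exp_op (galerkin_op L (H N)) t z"
  shows "exp_op (galerkin_op L (H N)) t z = S t z"
proof -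
  have gen: "R (e k) = S t (e k)" if "k \<in> {1..N}" for k
  proof -
    have ek: "e k \<in> H N" using that by (simp add: H[OF N] span_base)
    obtain \<mu> where \<mu>: "L (e k) = \<mu> *\<^sub>R e k" "S t (e k) = exp (\<mu> * t) *\<^sub>R e k"
    proof (rule semigroup_eigen)
      show "k \<ge> 1" using \<open>k \<in> {1..N}\<close> by simp
    qed (use t in blast)
    have "galerkin_op L (H N) (c *\<^sub>R e k) = (\<mu> * c) *\<^sub>R e k" for c
    proof -
      have in_H: "b *\<^sub>R e k \<in> H N" for b using ek by (simp add: H[OF N] span_scale)
      have "L (c *\<^sub>R e k) = (\<mu> * c) *\<^sub>R e k"
        using is_generator_scaleR[OF semigroup(2)] eigen[of k] that \<mu>(1) by (simp add: mult.commute)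
      then show ?thesis
        using orth_proj_id[OF _ H[OF N] in_H] by (simp add: galerkin_op_def)
    qed
    then have "exp_op (galerkin_op L (H N)) t (e k) = exp (\<mu> * t) *\<^sub>R e k"
      by (rule exp_op_eigenvector)
    then show ?thesis using R[OF ek] \<mu>(2) by simp
  qed
  have "R z = S t z" using z unfolding H[OF N]
  proof (induction rule: span_induct_alt)
    case base
    then show ?case by simp
  next
    case (step c v w)
    then show ?case using gen by (auto simp: blinfun.add_right blinfun.scaleR_right)
  qed
  then show ?thesis using R[OF z] by simp
qed

end

section \<open>Error estimates\<close>

text \<open>Costs lie in [0, \<infinity>], so the cost estimate is put as joint finiteness plus a
  bound on the finite values. \<gamma> is chosen before \<open>N\<close> and the control.\<close>

theorem corollary2p2:
  fixes S :: "real \<Rightarrow> 'h::{real_inner, banach, second_countable_topology} \<Rightarrow>\<^sub>L 'h"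
    and SN :: "nat \<Rightarrow> real \<Rightarrow> 'h \<Rightarrow>\<^sub>L 'h"
    and D :: "'h set" and L :: "'h \<Rightarrow> 'h"
    and M \<omega> :: real
    and F :: "'h \<Rightarrow> 'h"
    and C :: "'v::{real_inner, banach, second_countable_topology} \<Rightarrow> 'h"
    and H :: "nat \<Rightarrow> 'h set"
    and e :: "nat \<Rightarrow> 'h"
    and T q :: real and U :: "'v set"
    and bd :: "real \<Rightarrow> 'h \<Rightarrow> real"
    and G :: "'h \<Rightarrow> real" and E :: "'v \<Rightarrow> real"
    and ustar :: "real \<Rightarrow> 'h \<Rightarrow> real \<Rightarrow> 'v"
    and ustarN :: "nat \<Rightarrow> real \<Rightarrow> 'h \<Rightarrow> real \<Rightarrow> 'v"
    and x :: 'h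
    and \<sigma> LipG :: real and W :: "(real \<Rightarrow> 'v) set"
  assumes C_zero: "C 0 = 0"
    and semigroup: "c0_semigroup S" "is_generator S D L"
    and growth_bound: "M \<ge> 1" "\<omega> \<ge> 0" "\<And>t. t \<ge> 0 \<Longrightarrow> norm (S t) \<le> M * exp (\<omega> * t)"
    and galerkin_spaces:
      "\<And>N. N \<ge> 1 \<Longrightarrow> subspace (H N)"
      "\<And>N. N \<ge> 1 \<Longrightarrow> \<exists>B. finite B \<and> H N = span B"
      "\<And>N. N \<ge> 1 \<Longrightarrow> H N \<subseteq> D"
      "\<And>z. (\<lambda>N. norm (orth_proj (H N) z - z)) \<longlonglongrightarrow> 0"
    and T_pos: "T > 0" and q_ge_1: "q \<ge> 1" and U_bounded: "bounded U"
    and a_semigroups: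
      "\<And>N. N \<ge> 1 \<Longrightarrow> c0_semigroup (SN N)"
      "\<And>N t z. N \<ge> 1 \<Longrightarrow> t \<ge> 0 \<Longrightarrow> z \<in> H N \<Longrightarrow> SN N t z = exp_op (galerkin_op L (H N)) t z"
      "\<And>N t. N \<ge> 1 \<Longrightarrow> t \<ge> 0 \<Longrightarrow> norm (SN N t) \<le> M * exp (\<omega> * t)"
    and a_consistent: "\<And>\<phi>. \<phi> \<in> D \<Longrightarrow> (\<lambda>N. norm (galerkin_op L (H N) \<phi> - L \<phi>)) \<longlonglongrightarrow> 0"
    and a_F: "locally_lipschitz F"
    and b_self_adjoint: "self_adjoint D L"
    and b_eigen: "\<And>k. k \<ge> 1 \<Longrightarrow> e k \<noteq> 0 \<and> e k \<in> D \<and> (\<exists>\<mu>. L (e k) = \<mu> *\<^sub>R e k)"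
    and b_span: "\<And>N. N \<ge> 1 \<Longrightarrow> H N = span (e ` {1..N})"
    and c_state: "\<And>T' z u. T' > 0 \<Longrightarrow> u \<in> admissible q U T' \<Longrightarrow>
        uniquely_solvable 0 T' (is_state_solution S F C 0 T' z u)"
    and c_galerkin: "\<And>T' z u N. T' > 0 \<Longrightarrow> u \<in> admissible q U T' \<Longrightarrow> N \<ge> 1 \<Longrightarrow>
        uniquely_solvable 0 T'
          (is_galerkin_solution L (H N) F C 0 T' (orth_proj (H N) z) u)"
    and c_bounds: "\<And>T' z u N t. T' > 0 \<Longrightarrow> u \<in> admissible q U T' \<Longrightarrow> N \<ge> 1 \<Longrightarrow> t \<in> {0..T'} \<Longrightarrow>
        norm (state_sol S F C 0 T' z u t) \<le> bd T' z \<and>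
        norm (galerkin_sol L (H N) F C 0 T' (orth_proj (H N) z) u t) \<le> bd T' z"
    and d_G: "\<And>z. G z \<ge> 0" "locally_lipschitz G"
    and d_E: "\<And>v. E v \<ge> 0" "continuous_on UNIV E"
    and e_min: "\<And>t z. t \<in> {0..<T} \<Longrightarrow>
        is_arg_min (cost_J S F C G E T t z) (\<lambda>u. u \<in> admissible_from q U t T) (ustar t z)"
    and e_minN: "\<And>t z N. t \<in> {0..<T} \<Longrightarrow> N \<ge> 1 \<Longrightarrow>
        is_arg_min (cost_JN L (H N) F C G E T t (orth_proj (H N) z))
          (\<lambda>u. u \<in> admissible_from q U t T) (ustarN N t (orth_proj (H N) z))"
    and sigma_pos: "\<sigma> > 0"
    and W_nhd: "W \<subseteq> admissible q U T"
      "\<exists>\<epsilon>>0. \<forall>v\<in>admissible q U T. Lp_norm q 0 T (\<lambda>s. ustar 0 x s - v s) < \<epsilon> \<longrightarrow> v \<in> W"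
    and growth: "\<And>v. v \<in> W \<Longrightarrow>
        ennreal (\<sigma> * Lp_norm q 0 T (\<lambda>s. ustar 0 x s - v s) powr q)
          \<le> cost_J S F C G E T 0 x v - cost_J S F C G E T 0 x (ustar 0 x)"
    and LipG: "LipG > 0" "LipG-lipschitz_on (cball 0 (bd T x)) G"
  shows "\<exists>\<gamma>>0.
     (\<forall>N\<ge>1. \<forall>u\<in>admissible q U T.
        (cost_J S F C G E T 0 x u < \<infinity> \<longleftrightarrow>
           cost_JN L (H N) F C G E T 0 (orth_proj (H N) x) u < \<infinity>) \<and>
        (cost_J S F C G E T 0 x u < \<infinity> \<longrightarrow>
           \<bar>enn2real (cost_J S F C G E T 0 x u)
              - enn2real (cost_JN L (H N) F C G E T 0 (orth_proj (H N) x) u)\<bar>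
           \<le> LipG * (sqrt T + \<gamma> * T) *
              Lp_norm 2 0 T (\<lambda>s. state_sol S F C 0 T x u s
                                  - orth_proj (H N) (state_sol S F C 0 T x u s)))) \<and>
     (\<forall>N\<ge>1. ustarN N 0 (orth_proj (H N) x) \<in> W \<longrightarrow>
        Lp_norm q 0 T (\<lambda>s. ustar 0 x s - ustarN N 0 (orth_proj (H N) x) s) powr q
        \<le> 1 / \<sigma> * LipG * (sqrt T + \<gamma> * T) *
           (Lp_norm 2 0 T (\<lambda>s. state_sol S F C 0 T x (ustar 0 x) s
                - orth_proj (H N) (state_sol S F C 0 T x (ustar 0 x) s))
            + 2 * Lp_norm 2 0 T (\<lambda>s. state_sol S F C 0 T x (ustarN N 0 (orth_proj (H N) x)) s
                - orth_proj (H N) (state_sol S F C 0 T x (ustarN N 0 (orth_proj (H N) x)) s))))"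
proof -
  have dense: "(\<lambda>N. orth_proj (H N) z) \<longlonglongrightarrow> z" for z
    using galerkin_spaces(4)[of z] by (simp add: LIM_zero_iff tendsto_norm_zero_iff)
  have M: "M \<ge> 0" using growth_bound(1) by simp
  have eigen: "e k \<in> D \<and> (\<exists>\<mu>. L (e k) = \<mu> *\<^sub>R e k)" if "k \<ge> 1" for k
    using b_eigen[OF that] by blast
  define y where "y = state_sol S F C 0 T x"
  define yN where "yN N = galerkin_sol L (H N) F C 0 T (orth_proj (H N) x)" for N
  define R where "R N u = Lp_norm 2 0 T (\<lambda>s. y u s - orth_proj (H N) (y u s))" for N u
  define J where "J = cost_J S F C G E T 0 x"
  define JN where "JN N = cost_JN L (H N) F C G E T 0 (orth_proj (H N) x)" for N
  \<comment> \<open>The maximum with 1 keeps the radius positive, as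
    \<open>locally_lipschitz\<close> demands, even if \<open>bd T x\<close> is zero.\<close>
  define r where "r = max 1 (bd T x)"
  obtain l where l: "l > 0" "l-lipschitz_on (cball 0 r) F"
    using a_F unfolding locally_lipschitz_def r_def by (meson less_max_iff_disj zero_less_one)
  define B where "B = M * exp (\<omega> * T)"
  have B: "B > 0" using growth_bound(1) by (simp add: B_def)
  \<comment> \<open>The Gronwall constant for the error between projected and Galerkin solution.
    With \<gamma> = K sqrt T below, (1 + K T) sqrt T becomes sqrt T + \<gamma> T; neither
    \<open>K\<close> nor \<gamma> depends on \<open>N\<close> or the control.\<close>
  define K where "K = B * l * exp (B * l * T)"
  have K: "K > 0" using B l by (simp add: K_def)
  define \<gamma> where "\<gamma> = K * sqrt T"
  have \<gamma>: "\<gamma> > 0" using K T_pos by (simp add: \<gamma>_def)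

  \<comment> \<open>Cost estimate\<close>
  have first: "(J u < \<infinity> \<longleftrightarrow> JN N u < \<infinity>) \<and> (J u < \<infinity> \<longrightarrow>
      \<bar>enn2real (J u) - enn2real (JN N u)\<bar> \<le> LipG * (sqrt T + \<gamma> * T) * R N u)"
    if N: "N \<ge> 1" and u: "u \<in> admissible q U T" for N u
  proof -
    let ?P = "orth_proj (H N)"
    note P = bounded_linear_orth_proj[OF _ b_span[OF N]] norm_orth_proj_le[OF _ b_span[OF N]]
      orth_proj_in[OF _ b_span[OF N]]
    have sol: "is_state_solution S F C 0 T x u (y u)"
      unfolding y_def state_sol_def by (rule uniquely_solvable_someI[OF c_state[OF T_pos u]])
    have solN: "is_galerkin_solution L (H N) F C 0 T (?P x) u (yN N u)"
      unfolding yN_def galerkin_sol_def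
      by (rule uniquely_solvable_someI[OF c_galerkin[OF T_pos u N]])
    have cont: "continuous_on {0..T} (y u)" "continuous_on {0..T} (yN N u)"
      using sol solN by (auto simp: is_state_solution_def is_galerkin_solution_def mild_solution_def)
    have contP: "continuous_on {0..T} (\<lambda>s. ?P (y u s))"
      by (rule bounded_linear.continuous_on[OF P(1) cont(1)]) simp
    have bdd: "norm (y u s) \<le> bd T x" "norm (yN N u s) \<le> bd T x" if "s \<in> {0..T}" for s
      using c_bounds[OF T_pos u N that] by (auto simp: y_def yN_def)
    define I where "I = integral {0..T} (\<lambda>s. norm (y u s - ?P (y u s)))"
    have IR: "I \<le> sqrt T * R N u"
      unfolding I_def R_def by (intro integral_le_L2 T_pos continuous_intros cont contP)
    have w: "norm (?P (y u s) - yN N u s) \<le> K * I" if s: "s \<in> {0..T}" for s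
    proof -
      have "norm (?P (y u s) - yN N u s) \<le> B * l * I * exp (B * l * T)"
        unfolding I_def
      proof (rule projected_mild_solution_error[OF P(1,2) _ _ sol[unfolded is_state_solution_def]
            solN[unfolded is_galerkin_solution_def] l(2) _ _ s])
        fix t z assume t: "(0::real) \<le> t"
        show "exp_op (galerkin_op L (H N)) t (?P z) = ?P (S t z)"
          using exp_galerkin_op[OF semigroup M growth_bound(2,3) b_self_adjoint eigen b_span N t P(3)
              a_semigroups(2)[OF N t]]
            orth_proj_semigroup[OF semigroup M growth_bound(2,3) b_self_adjoint eigen b_span dense N t]
          by simp
      next
        fix t assume t: "t \<in> {0..T}"
        then have "norm (S t) \<le> M * exp (\<omega> * t)" using growth_bound(3) by simp
        also have "\<dots> \<le> B" unfolding B_def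
          using t M growth_bound(2) by (intro mult_left_mono) (auto intro: mult_left_mono)
        finally show "norm (S t) \<le> B" .
      qed (use bdd in \<open>auto simp: r_def intro: max.coboundedI2\<close>)
      then show ?thesis by (simp add: K_def mult_ac)
    qed
    \<comment> \<open>The full error is the projection error plus a part bounded uniformly in time
      by \<open>K * I\<close>; integrating the latter over [0, T] yields the factor
      \<open>T\<close>.\<close>
    have "integral {0..T} (\<lambda>s. norm (y u s - yN N u s))
        \<le> integral {0..T} (\<lambda>s. norm (y u s - ?P (y u s)) + K * I)"
    proof (rule integral_le)
      fix s assume "s \<in> {0..T}"
      then show "norm (y u s - yN N u s) \<le> norm (y u s - ?P (y u s)) + K * I"
        using norm_triangle_ineq[of "y u s - ?P (y u s)" "?P (y u s) - yN N u s"] w[of s] by simp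
    qed (intro integrable_continuous_real continuous_intros cont contP)+
    also have "\<dots> = I + K * I * T"
      unfolding I_def
      by (subst integral_add) (use T_pos in \<open>auto simp: mult.commute intro!: integrable_continuous_real continuous_intros cont contP\<close>)
    also have "\<dots> = (1 + K * T) * I" by (simp add: algebra_simps)
    also have "\<dots> \<le> (1 + K * T) * (sqrt T * R N u)"
      using IR K T_pos by (intro mult_left_mono) auto
    also have "\<dots> = (sqrt T + \<gamma> * T) * R N u" by (simp add: \<gamma>_def algebra_simps)
    finally have le: "LipG * integral {0..T} (\<lambda>s. norm (y u s - yN N u s))
        \<le> LipG * (sqrt T + \<gamma> * T) * R N u"
      using LipG(1) by (simp add: mult.assoc)
    have "u \<in> borel_measurable (lebesgue_on {0..T})" using u by (simp add: admissible_def)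
    note cost_difference_le[OF cont bdd d_G(1) LipG(2) d_E this]
    then show ?thesis using le
      unfolding J_def JN_def cost_J_def cost_JN_def y_def yN_def by fastforce
  qed

  \<comment> \<open>Minimizers and control estimate\<close>
  have R_nonneg: "R N u \<ge> 0" for N u by (simp add: R_def Lp_norm_def)
  have min: "ustar 0 x \<in> admissible q U T" "\<And>u. u \<in> admissible q U T \<Longrightarrow> J (ustar 0 x) \<le> J u"
    using e_min[of 0 x] T_pos by (auto simp: is_arg_min_linorder admissible_from_0 J_def)
  obtain c where c: "(\<lambda>_. c) \<in> admissible q U T"
    using admissible_const[OF min(1) T_pos] by blast
  \<comment> \<open>A constant control keeps \<open>E\<close> constant, and its trajectory is
    bounded, so its cost is finite and bounds the minimum. This rules out \<infinity> - \<infinity>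
    in the growth condition.\<close>
  have J_fin: "J (ustar 0 x) < \<infinity>"
  proof -
    have bdd: "norm (y (\<lambda>_. c) s) \<le> bd T x" if "s \<in> {0..T}" for s
      using c_bounds[OF T_pos c _ that, of 1] by (simp add: y_def)
    have "J (\<lambda>_. c) \<le> (\<integral>\<^sup>+ s. ennreal (G 0 + LipG * bd T x + E c) \<partial>lebesgue_on {0..T})"
      unfolding J_def cost_J_def y_def[symmetric]
    proof (intro nn_integral_mono ennreal_leI add_right_mono)
      fix s assume "s \<in> space (lebesgue_on {0..T})"
      then have s: "norm (y (\<lambda>_. c) s) \<le> bd T x" using bdd by simp
      then have "0 \<le> bd T x" using norm_ge_zero order_trans by blast
      then have "\<bar>G (y (\<lambda>_. c) s) - G 0\<bar> \<le> LipG * norm (y (\<lambda>_. c) s)"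
        using lipschitz_onD[OF LipG(2), of "y (\<lambda>_. c) s" 0] s by (simp add: dist_norm)
      also have "\<dots> \<le> LipG * bd T x" using s LipG(1) by simp
      finally show "G (y (\<lambda>_. c) s) \<le> G 0 + LipG * bd T x" by linarith
    qed
    also have "\<dots> < \<infinity>"
      using T_pos by (simp add: emeasure_restrict_space ennreal_mult_less_top)
    finally have "J (\<lambda>_. c) < \<infinity>" .
    then show ?thesis using min(2)[OF c] by simp
  qed
  have second: "Lp_norm q 0 T (\<lambda>s. ustar 0 x s - v s) powr q
      \<le> 1 / \<sigma> * LipG * (sqrt T + \<gamma> * T) * (R N (ustar 0 x) + 2 * R N v)"
    if N: "N \<ge> 1" and v: "v = ustarN N 0 (orth_proj (H N) x)" "v \<in> W" for N v
  proof -
    let ?u = "ustar 0 x"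
    define X where "X = Lp_norm q 0 T (\<lambda>s. ?u s - v s) powr q"
    have vad: "v \<in> admissible q U T" using v W_nhd by auto
    have minN: "JN N v \<le> JN N ?u"
      using e_minN[of 0 N x] T_pos N v(1) min(1)
      by (auto simp: is_arg_min_linorder admissible_from_0 JN_def)
    note fu = first[OF N min(1)] and fv = first[OF N vad]
    \<comment> \<open>Finiteness travels from \<open>J ?u\<close> to \<open>JN N ?u\<close>, by
      Galerkin minimality to \<open>JN N v\<close>, and back to \<open>J v\<close>.\<close>
    have fin: "JN N ?u < \<infinity>" "JN N v < \<infinity>" "J v < \<infinity>"
      using fu fv J_fin minN by (auto intro: le_less_trans)
    have "ennreal (\<sigma> * X) \<le> J v - J ?u" using growth[OF v(2)] by (simp add: J_def X_def)
    also have "\<dots> = ennreal (enn2real (J v) - enn2real (J ?u))"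
      using fin J_fin by (simp add: ennreal_minus[symmetric])
    \<comment> \<open>Subtraction in \<open>ennreal\<close> truncates at 0. Minimality of
      \<open>?u\<close> makes the real difference nonnegative, so the inequality descends to the
      reals.\<close>
    finally have "\<sigma> * X \<le> enn2real (J v) - enn2real (J ?u)"
      using min(2)[OF vad] fin(3) by (subst (asm) ennreal_le_iff) (auto intro!: enn2real_mono)
    \<comment> \<open>Inserting \<open>JN N v\<close> \<le> \<open>JN N ?u\<close> bounds the
      difference by the two cost errors at \<open>v\<close> and \<open>?u\<close>.\<close>
    also have "\<dots> \<le> LipG * (sqrt T + \<gamma> * T) * R N v + LipG * (sqrt T + \<gamma> * T) * R N ?u"
      using fu fv J_fin fin enn2real_mono[OF minN] by auto
    also have "\<dots> \<le> LipG * (sqrt T + \<gamma> * T) * (R N ?u + 2 * R N v)"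
      using LipG(1) \<gamma> T_pos R_nonneg[of N v] by (simp add: distrib_left)
    finally show ?thesis using sigma_pos unfolding X_def[symmetric] by (simp add: field_simps)
  qed
  show ?thesis
    using \<gamma> first second unfolding J_def JN_def R_def y_def yN_def by blast
qed

end
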